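(* Let $n\in\{2,3\}$, $A>0$, $\gamma>1$, and let $\mu,\lambda$ be constants with $\mu>0$ and $n\lambda+2\mu>0$. For any $T>0$, the pair $$\rho(t,x)=C_n^{\frac{1}{\gamma-1}}\Big(\frac{|x|}{T-t}\Big)^{\frac{2}{\gamma-1}},\qquad u(t,x)=-\frac{2x}{[n(\gamma-1)+2](T-t)},\qquad (t,x)\in[0,T)\times\mathbb{R}^n,$$ solves the compressible Navier-Stokes equations $$\begin{cases}\partial_t\rho+\nabla\cdot(\rho u)=0,\\ \partial_t(\rho u)+\nabla\cdot(\rho u\otimes u)+\nabla(A\rho^\gamma)=\mu\Delta u+(\lambda+\mu)\nabla(\nabla\cdot u),\end{cases}$$ on $[0,T)\times\mathbb{R}^n$, where the constants $C_n$ are given by $$C_2=\frac{(\gamma-1)^2}{2A\gamma^3},\qquad C_3=\frac{3(\gamma-1)^2}{A\gamma(3\gamma-1)^2}.$$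
   Context: Here $\rho$ is the (nonnegative) density and $u$ the $\mathbb{R}^n$-valued velocity; the equations are understood pointwise in the conservative form displayed. *)

theory Defs
  imports "HOL-Analysis.Analysis"
begin

definition partial_deriv :: "'n::finite \<Rightarrow> (real^'n \<Rightarrow> 'b::real_normed_vector) \<Rightarrow> real^'n \<Rightarrow> 'b" where
  "partial_deriv j f x = frechet_derivative f (at x) (axis j 1)"

definition gradient :: "(real^'n::finite \<Rightarrow> real) \<Rightarrow> real^'n \<Rightarrow> real^'n" where
  "gradient f x = (\<chi> i. partial_deriv i f x)"

definition divergence :: "(real^'n::finite \<Rightarrow> real^'n) \<Rightarrow> real^'n \<Rightarrow> real" where
  "divergence F x = (\<Sum>i\<in>UNIV. partial_deriv i F x $ i)"

definition tensor_divergence :: "(real^'n::finite \<Rightarrow> real^'n^'n) \<Rightarrow> real^'n \<Rightarrow> real^'n" where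
  "tensor_divergence M x = (\<chi> i. \<Sum>j\<in>UNIV. partial_deriv j M x $ i $ j)"

definition laplacian :: "(real^'n::finite \<Rightarrow> 'b::real_normed_vector) \<Rightarrow> real^'n \<Rightarrow> 'b" where
  "laplacian f x = (\<Sum>j\<in>UNIV. partial_deriv j (partial_deriv j f) x)"

definition tensor_product :: "real^'n \<Rightarrow> real^'n \<Rightarrow> real^'n^'n" where
  "tensor_product v w = (\<chi> i j. v $ i * w $ j)"

text \<open>
  Since \<^const>\<open>frechet_derivative\<close> and \<^const>\<open>vector_derivative\<close> are total, a pointwise solution must
  explicitly have all derivatives that occur in the equations.  The conservative form
  differentiates only \<open>\<rho> u\<close>, \<open>\<rho> u \<otimes> u\<close>, \<open>A \<rho>\<^sup>\<gamma>\<close> and \<open>u\<close> in space; spatial differentiability of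
  \<open>\<rho>\<close> itself is deliberately not required.  Time derivatives are taken
  within the time interval \<open>I\<close>, hence are one-sided at an endpoint belonging to \<open>I\<close>.
\<close>

definition NS_regular_at ::
  "real \<Rightarrow> real \<Rightarrow> real set \<Rightarrow> (real \<Rightarrow> real^'n::finite \<Rightarrow> real) \<Rightarrow> (real \<Rightarrow> real^'n \<Rightarrow> real^'n)
    \<Rightarrow> real \<Rightarrow> real^'n \<Rightarrow> bool" where
  "NS_regular_at A \<gamma> I \<rho> u t x \<longleftrightarrow>
     (\<lambda>s. \<rho> s x) differentiable (at t within I) \<and>
     (\<lambda>s. \<rho> s x *\<^sub>R u s x) differentiable (at t within I) \<and>
     (\<lambda>y. \<rho> t y *\<^sub>R u t y) differentiable (at x) \<and>
     (\<lambda>y. \<rho> t y *\<^sub>R tensor_product (u t y) (u t y)) differentiable (at x) \<and>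
     (\<lambda>y. A * \<rho> t y powr \<gamma>) differentiable (at x) \<and>
     (\<forall>y. u t differentiable (at y)) \<and>
     (\<forall>j. partial_deriv j (u t) differentiable (at x))"

definition NS_solution ::
  "real \<Rightarrow> real \<Rightarrow> real \<Rightarrow> real \<Rightarrow> real set
    \<Rightarrow> (real \<Rightarrow> real^'n::finite \<Rightarrow> real) \<Rightarrow> (real \<Rightarrow> real^'n \<Rightarrow> real^'n) \<Rightarrow> bool" where
  "NS_solution A \<gamma> \<mu> lam I \<rho> u \<longleftrightarrow>
     (\<forall>t\<in>I. \<forall>x.
        0 \<le> \<rho> t x \<and>
        NS_regular_at A \<gamma> I \<rho> u t x \<and>
        vector_derivative (\<lambda>s. \<rho> s x) (at t within I)
          + divergence (\<lambda>y. \<rho> t y *\<^sub>R u t y) x = 0 \<and>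
        vector_derivative (\<lambda>s. \<rho> s x *\<^sub>R u s x) (at t within I)
          + tensor_divergence (\<lambda>y. \<rho> t y *\<^sub>R tensor_product (u t y) (u t y)) x
          + gradient (\<lambda>y. A * \<rho> t y powr \<gamma>) x
        = \<mu> *\<^sub>R laplacian (u t) x + (lam + \<mu>) *\<^sub>R gradient (divergence (u t)) x)"

end

theory Submission
  imports Defs
begin

text \<open>
  Put \<open>n = CARD('n)\<close>, \<open>a = 2 / (\<gamma> - 1)\<close>, \<open>k = 2 / (n * (\<gamma> - 1) + 2)\<close>, \<open>\<tau> = T - t\<close> and
  \<open>K = C powr (1 / (\<gamma> - 1))\<close>, so that \<open>\<rho> = K \<tau>\<^sup>-\<^sup>a |x|\<^sup>a\<close> and \<open>u = - (k / \<tau>) x\<close>.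

  The velocity is linear in \<open>x\<close>, with constant divergence, so both viscous terms vanish.  What
  remains is an Euler system for powers of \<open>|x|\<close> and \<open>\<tau>\<close>, where every term of one equation has
  the same shape.  With \<open>div (|x|\<^sup>a x) = (a + n) |x|\<^sup>a\<close> the continuity equation is a multiple of
  \<open>a - k (a + n) = 0\<close>, which is how \<open>k\<close> is determined.  In the momentum equation, \<open>a \<gamma> = a + 2\<close>
  and \<open>K\<^sup>\<gamma> = K C\<close>, so all terms are multiples of \<open>K \<tau>\<^sup>-\<^sup>a\<^sup>-\<^sup>2 |x|\<^sup>a x\<close> and what is left is
  \<open>- k (a + 1) + k\<^sup>2 (a + n + 1) + A C (a + 2) = 0\<close>.  By the relation for \<open>k\<close> this
  reads \<open>A C (a + 2) = k (1 - k)\<close>, and the given values of \<open>C\<close> in dimensions 2 and 3 are exactly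
  its solutions.

  The analytic point is the origin: for \<open>\<gamma> \<ge> 3\<close> the exponent \<open>a\<close> is at most 1 and \<open>|x|\<^sup>a\<close> is not
  differentiable there.  The equations, however, only differentiate in space \<open>|x|\<^sup>a F(x)\<close> with \<open>F\<close>
  differentiable and \<open>F 0 = 0\<close>, and such products are differentiable everywhere
  (\<open>has_derivative_norm_powr_scaleR\<close>).
\<close>

section \<open>Powers of the norm times a differentiable function\<close>

text \<open>
  Near a common zero, \<open>F\<close> is at most of the order of the distance, and the factor \<open>g\<close>
  makes the product of smaller order, even if \<open>g\<close> is not differentiable there.
\<close>

lemma has_derivative_scaleR_common_zero:
  fixes g :: "'a::real_normed_vector \<Rightarrow> real" and F :: "'a \<Rightarrow> 'b::real_normed_vector"
  assumes F: "(F has_derivative F') (at x)" and "isCont g x" "g x = 0" "F x = 0"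
  shows "((\<lambda>y. g y *\<^sub>R F y) has_derivative (\<lambda>h. 0)) (at x)"
  unfolding has_derivative_at_alt
proof (intro conjI allI impI)
  fix e :: real assume "e > 0"
  have "bounded_linear F'" using F by (rule has_derivative_bounded_linear)
  then obtain B where B: "B > 0" "\<And>h. norm (F' h) \<le> norm h * B"
    using bounded_linear.pos_bounded by blast
  from F obtain d1 where d1: "d1 > 0"
    "\<And>y. norm (y - x) < d1 \<Longrightarrow> norm (F y - F x - F' (y - x)) \<le> 1 * norm (y - x)"
    unfolding has_derivative_at_alt using zero_less_one by blast
  have "e / (B + 1) > 0" using \<open>e > 0\<close> B by simp
  then obtain d2 where d2: "d2 > 0" "\<And>y. dist y x < d2 \<Longrightarrow> dist (g y) (g x) < e / (B + 1)"
    using \<open>isCont g x\<close> unfolding continuous_at_eps_delta by blast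
  show "\<exists>d>0. \<forall>y. norm (y - x) < d \<longrightarrow>
          norm (g y *\<^sub>R F y - g x *\<^sub>R F x - 0) \<le> e * norm (y - x)"
  proof (intro exI[of _ "min d1 d2"] conjI allI impI)
    fix y assume y: "norm (y - x) < min d1 d2"
    have "norm (F y - F' (y - x)) \<le> norm (y - x)"
      using d1(2)[of y] y \<open>F x = 0\<close> by simp
    then have "norm (F y) \<le> norm (y - x) + norm (y - x) * B"
      using B(2)[of "y - x"] norm_triangle_sub[of "F y" "F' (y - x)"] by linarith
    then have Fy: "norm (F y) \<le> (B + 1) * norm (y - x)" by (simp add: algebra_simps)
    have "\<bar>g y\<bar> \<le> e / (B + 1)"
      using d2(2)[of y] y \<open>g x = 0\<close> by (simp add: dist_norm)
    then have "\<bar>g y\<bar> * norm (F y) \<le> e / (B + 1) * ((B + 1) * norm (y - x))"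
      using Fy B \<open>e > 0\<close> by (intro mult_mono) auto
    then show "norm (g y *\<^sub>R F y - g x *\<^sub>R F x - 0) \<le> e * norm (y - x)"
      using \<open>F x = 0\<close> B by simp
  qed (use d1 d2 in auto)
qed simp

text \<open>
  Away from the origin this is the product rule.  At the origin the displayed derivative is zero
  because \<open>0 powr b = 0\<close> for every \<open>b\<close>, negative ones included, so one formula covers both cases.
\<close>

lemma has_derivative_norm_powr_scaleR:
  fixes F :: "'a::real_inner \<Rightarrow> 'b::real_normed_vector"
  assumes F: "(F has_derivative F') (at x)" and "a > 0" and zero: "x = 0 \<Longrightarrow> F x = 0"
  shows "((\<lambda>y. (norm y powr a) *\<^sub>R F y) has_derivative
           (\<lambda>h. (norm x powr a) *\<^sub>R F' h + (a * norm x powr (a - 2) * (x \<bullet> h)) *\<^sub>R F x)) (at x)"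
proof (cases "x = 0")
  case True
  have "isCont (\<lambda>y::'a. norm y powr a) x"
    using \<open>a > 0\<close> by (intro continuous_intros) auto
  from has_derivative_scaleR_common_zero[OF F this] show ?thesis
    using True zero by simp
next
  case False
  have *: "norm x powr a = norm x powr (a - 2) * (norm x * norm x)"
    using False by (simp add: powr_diff power2_eq_square)
  have "((\<lambda>y. norm y powr a) has_derivative
          (\<lambda>h. norm x powr a * (0 * ln (norm x) + (x \<bullet> h / norm x) * a / norm x))) (at x)"
    using False by (auto intro!: derivative_eq_intros has_derivative_norm simp: sgn_div_norm inner_commute divide_simps)
  moreover have "norm x powr a * (0 * ln (norm x) + (x \<bullet> h / norm x) * a / norm x)
      = a * norm x powr (a - 2) * (x \<bullet> h)" for h
    unfolding * using False by (simp add: field_simps)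
  ultimately have "((\<lambda>y. norm y powr a) has_derivative
      (\<lambda>h. a * norm x powr (a - 2) * (x \<bullet> h))) (at x)"
    by simp
  from has_derivative_scaleR[OF this F] show ?thesis by (simp add: add.commute)
qed

lemma norm_powr_mult_norm_sq: "norm x powr (a - 2) * (norm x)\<^sup>2 = norm x powr a"
  by (cases "x = 0") (simp_all add: powr_diff)

section \<open>Differential operators on homogeneous fields\<close>

lemma partial_deriv_eq:
  "(f has_derivative f') (at x) \<Longrightarrow> partial_deriv j f x = f' (axis j 1)"
  unfolding partial_deriv_def by (metis frechet_derivative_at)

lemma sum_axis_nth_mult: "(\<Sum>j\<in>UNIV. axis j (1::real) $ i * f j) = f i"
  by (simp add: axis_def if_distrib[of "\<lambda>z. z * _"] cong: if_cong)

lemma sum_nth_mult_self: "(\<Sum>j\<in>UNIV. x $ j * x $ j) = (norm (x::real^'n::finite))\<^sup>2"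
  by (simp add: power2_norm_eq_inner inner_vec_def)

lemma norm_powr_field:
  fixes x :: "real^'n::finite"
  assumes "a > 0"
  shows "(\<lambda>y. (norm y powr a) *\<^sub>R (c *\<^sub>R y)) differentiable (at x)"
    and "divergence (\<lambda>y. (norm y powr a) *\<^sub>R (c *\<^sub>R y)) x = c * (a + CARD('n)) * norm x powr a"
proof -
  have "((\<lambda>y. c *\<^sub>R y) has_derivative (\<lambda>h. c *\<^sub>R h)) (at x)"
    by (auto intro!: derivative_eq_intros)
  from has_derivative_norm_powr_scaleR[OF this \<open>a > 0\<close>]
  have D: "((\<lambda>y. (norm y powr a) *\<^sub>R (c *\<^sub>R y)) has_derivative
      (\<lambda>h. (norm x powr a) *\<^sub>R (c *\<^sub>R h) + (a * norm x powr (a - 2) * (x \<bullet> h)) *\<^sub>R (c *\<^sub>R x))) (at x)"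
    by simp
  show "(\<lambda>y. (norm y powr a) *\<^sub>R (c *\<^sub>R y)) differentiable (at x)"
    using D by (auto simp: differentiable_def)
  have "divergence (\<lambda>y. (norm y powr a) *\<^sub>R (c *\<^sub>R y)) x =
     (\<Sum>i\<in>UNIV. c * norm x powr a + c * a * norm x powr (a - 2) * (x $ i * x $ i))"
    unfolding divergence_def partial_deriv_eq[OF D]
    by (intro sum.cong) (auto simp: inner_axis algebra_simps)
  also have "\<dots> = c * norm x powr a * CARD('n) + c * a * (norm x powr (a - 2) * (norm x)\<^sup>2)"
    by (simp add: sum.distrib sum_distrib_left[symmetric] sum_nth_mult_self)
  finally show "divergence (\<lambda>y. (norm y powr a) *\<^sub>R (c *\<^sub>R y)) x = c * (a + CARD('n)) * norm x powr a"
    unfolding norm_powr_mult_norm_sq by (simp add: algebra_simps)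
qed

lemma has_derivative_tensor_product_self:
  "((\<lambda>y. tensor_product y y) has_derivative
     (\<lambda>h. tensor_product x h + tensor_product h x)) (at (x::real^'n::finite))"
proof -
  have "bilinear (tensor_product :: real^'n \<Rightarrow> _ \<Rightarrow> _)"
    unfolding bilinear_def
    by (auto intro!: linearI simp: tensor_product_def vec_eq_iff algebra_simps)
  then have "bounded_bilinear (tensor_product :: real^'n \<Rightarrow> _ \<Rightarrow> _)"
    by (simp add: bilinear_conv_bounded_bilinear)
  then show ?thesis
    by (rule bounded_bilinear.FDERIV) (rule has_derivative_ident)+
qed

lemma norm_powr_tensor:
  fixes x :: "real^'n::finite"
  assumes "a > 0"
  shows "(\<lambda>y. (norm y powr a) *\<^sub>R (c *\<^sub>R tensor_product y y)) differentiable (at x)"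
    and "tensor_divergence (\<lambda>y. (norm y powr a) *\<^sub>R (c *\<^sub>R tensor_product y y)) x
           = (c * (a + CARD('n) + 1) * norm x powr a) *\<^sub>R x"
proof -
  have "((\<lambda>y. c *\<^sub>R tensor_product y y) has_derivative
      (\<lambda>h. c *\<^sub>R (tensor_product x h + tensor_product h x))) (at x)"
    by (intro has_derivative_scaleR_right has_derivative_tensor_product_self)
  moreover have "c *\<^sub>R tensor_product x x = 0" if "x = 0"
    using that by (simp add: tensor_product_def vec_eq_iff)
  ultimately have D: "((\<lambda>y. (norm y powr a) *\<^sub>R (c *\<^sub>R tensor_product y y)) has_derivative
      (\<lambda>h. (norm x powr a) *\<^sub>R (c *\<^sub>R (tensor_product x h + tensor_product h x))
         + (a * norm x powr (a - 2) * (x \<bullet> h)) *\<^sub>R (c *\<^sub>R tensor_product x x))) (at x)"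
    using \<open>a > 0\<close> by (intro has_derivative_norm_powr_scaleR)
  show "(\<lambda>y. (norm y powr a) *\<^sub>R (c *\<^sub>R tensor_product y y)) differentiable (at x)"
    using D by (auto simp: differentiable_def)
  show "tensor_divergence (\<lambda>y. (norm y powr a) *\<^sub>R (c *\<^sub>R tensor_product y y)) x
           = (c * (a + CARD('n) + 1) * norm x powr a) *\<^sub>R x"
  proof (rule vec_eq_iff[THEN iffD2], rule allI)
    fix i
    have "tensor_divergence (\<lambda>y. (norm y powr a) *\<^sub>R (c *\<^sub>R tensor_product y y)) x $ i =
      (\<Sum>j\<in>UNIV. c * norm x powr a * (axis j 1 $ i * x $ j) + c * norm x powr a * x $ i
          + c * a * norm x powr (a - 2) * x $ i * (x $ j * x $ j))"
      unfolding tensor_divergence_def partial_deriv_eq[OF D] vec_lambda_beta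
      by (intro sum.cong) (auto simp: inner_axis algebra_simps tensor_product_def)
    also have "\<dots> = c * norm x powr a * x $ i + c * norm x powr a * x $ i * CARD('n)
        + c * a * (norm x powr (a - 2) * (norm x)\<^sup>2) * x $ i"
      by (simp add: sum.distrib sum_distrib_left[symmetric] sum_nth_mult_self sum_axis_nth_mult)
    finally show "tensor_divergence (\<lambda>y. (norm y powr a) *\<^sub>R (c *\<^sub>R tensor_product y y)) x $ i
           = ((c * (a + CARD('n) + 1) * norm x powr a) *\<^sub>R x) $ i"
      unfolding norm_powr_mult_norm_sq by (simp add: algebra_simps)
  qed
qed

text \<open>
  The exponent is written \<open>a + 2\<close> so that the function is \<open>|y|\<^sup>a\<close> times the differentiable
  \<open>y \<bullet> y\<close>, which vanishes at the origin.
\<close>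

lemma norm_powr_gradient:
  fixes x :: "real^'n::finite"
  assumes "a > 0"
  shows "(\<lambda>y. c * norm y powr (a + 2)) differentiable (at x)"
    and "gradient (\<lambda>y. c * norm y powr (a + 2)) x = (c * (a + 2) * norm x powr a) *\<^sub>R x"
proof -
  have eq: "c * norm y powr (a + 2) = (norm y powr a) *\<^sub>R (c * (y \<bullet> y))" for y :: "real^'n"
    using norm_powr_mult_norm_sq[of y "a + 2"]
    by (cases "y = 0") (simp_all add: powr_add power2_norm_eq_inner[symmetric])
  have "((\<lambda>y. c * (y \<bullet> y)) has_derivative (\<lambda>h. c * (2 * (x \<bullet> h)))) (at x)"
    by (auto intro!: derivative_eq_intros simp: inner_commute)
  from has_derivative_norm_powr_scaleR[OF this \<open>a > 0\<close>]
  have D: "((\<lambda>y. c * norm y powr (a + 2)) has_derivative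
      (\<lambda>h. norm x powr a * (c * (2 * (x \<bullet> h)))
        + a * norm x powr (a - 2) * (x \<bullet> h) * (c * (x \<bullet> x)))) (at x)"
    unfolding eq by simp
  show "(\<lambda>y. c * norm y powr (a + 2)) differentiable (at x)"
    using D by (auto simp: differentiable_def)
  have "norm x powr a * (c * (2 * r)) + a * norm x powr (a - 2) * r * (c * (x \<bullet> x))
      = c * (a + 2) * norm x powr a * r" for r
    unfolding norm_powr_mult_norm_sq[of x a, symmetric] power2_norm_eq_inner
    by (simp add: algebra_simps)
  then show "gradient (\<lambda>y. c * norm y powr (a + 2)) x = (c * (a + 2) * norm x powr a) *\<^sub>R x"
    unfolding gradient_def partial_deriv_eq[OF D] by (simp add: vec_eq_iff inner_axis)
qed

lemma partial_deriv_const: "partial_deriv j (\<lambda>y. c) x = 0"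
  using partial_deriv_eq[OF has_derivative_const, of j c x] by simp

lemma partial_deriv_scaleR:
  "partial_deriv j (\<lambda>y::real^'n::finite. c *\<^sub>R y) = (\<lambda>x. c *\<^sub>R axis j 1)"
proof
  fix x :: "real^'n"
  have "((\<lambda>y. c *\<^sub>R y) has_derivative (\<lambda>h. c *\<^sub>R h)) (at x)"
    by (auto intro!: derivative_eq_intros)
  then show "partial_deriv j (\<lambda>y. c *\<^sub>R y) x = c *\<^sub>R axis j 1" by (rule partial_deriv_eq)
qed

lemma viscous_terms_scaleR:
  "laplacian (\<lambda>y. c *\<^sub>R y) x = 0" "gradient (divergence (\<lambda>y. c *\<^sub>R y)) x = 0"
  unfolding laplacian_def gradient_def divergence_def partial_deriv_scaleR
  by (simp_all add: partial_deriv_const vec_eq_iff)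

section \<open>The time derivative\<close>

lemma powr_blowup_time_derivative:
  fixes v :: "'a::real_normed_vector"
  assumes t: "t \<in> {0..<T}" and f: "\<And>s. s \<in> {0..<T} \<Longrightarrow> f s = ((T - s) powr - b) *\<^sub>R v"
  shows "f differentiable (at t within {0..<T})"
    and "vector_derivative f (at t within {0..<T}) = (b * (T - t) powr (- b - 1)) *\<^sub>R v"
proof -
  have "((\<lambda>s. (T - s) powr - b) has_real_derivative b * (T - t) powr (- b - 1))
      (at t within {0..<T})"
    using t by (auto intro!: derivative_eq_intros simp: powr_diff)
  from has_vector_derivative_scaleR[OF this has_vector_derivative_const[of v]]
  have "((\<lambda>s. ((T - s) powr - b) *\<^sub>R v) has_vector_derivative (b * (T - t) powr (- b - 1)) *\<^sub>R v)
      (at t within {0..<T})"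
    by simp
  then have D: "(f has_vector_derivative (b * (T - t) powr (- b - 1)) *\<^sub>R v) (at t within {0..<T})"
    by (rule has_vector_derivative_transform[OF t _, rotated]) (rule f)
  have "at t within {0..<T} \<noteq> bot"
    using t by (simp add: trivial_limit_within islimpt_Ico)
  then show "vector_derivative f (at t within {0..<T}) = (b * (T - t) powr (- b - 1)) *\<^sub>R v"
    using D by (rule vector_derivative_within)
  show "f differentiable (at t within {0..<T})"
    using D by (rule differentiableI_vector)
qed

section \<open>The self-similar solution\<close>

text \<open>
  The computation is the same in every dimension: the dimension enters through the value of \<open>k\<close>
  forced by the continuity equation, and \<open>C\<close> only through \<open>balance\<close>, the condition that the
  pressure gradient balances the acceleration \<open>(k\<^sup>2 - k) x / \<tau>\<^sup>2\<close> of the flow.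
\<close>

lemma self_similar_NS_solution:
  fixes A \<gamma> \<mu> lam T C :: real
    and \<rho> :: "real \<Rightarrow> real^'n::finite \<Rightarrow> real"
    and u :: "real \<Rightarrow> real^'n \<Rightarrow> real^'n"
  defines "a \<equiv> 2 / (\<gamma> - 1)" and "k \<equiv> 2 / (real CARD('n) * (\<gamma> - 1) + 2)"
  assumes "\<gamma> > 1" and "C > 0" and balance: "A * C * (a + 2) = k * (1 - k)"
    and \<rho>: "\<And>t x. t \<in> {0..<T} \<Longrightarrow> \<rho> t x = C powr (1 / (\<gamma> - 1)) * (norm x / (T - t)) powr a"
    and u: "\<And>t x. t \<in> {0..<T} \<Longrightarrow> u t x = - (k / (T - t)) *\<^sub>R x"
  shows "NS_solution A \<gamma> \<mu> lam {0..<T} \<rho> u"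
proof -
  define K where "K = C powr (1 / (\<gamma> - 1))"
  have "a > 0" using \<open>\<gamma> > 1\<close> by (simp add: a_def)
  have kan: "k * (a + CARD('n)) = a"
  proof -
    define q where "q = real CARD('n) * (\<gamma> - 1) + 2"
    have "q > 0" using \<open>\<gamma> > 1\<close> by (simp add: q_def add_nonneg_pos)
    moreover have "a + CARD('n) = q / (\<gamma> - 1)"
      using \<open>\<gamma> > 1\<close> by (simp add: a_def q_def field_simps)
    moreover have "k = 2 / q" by (simp add: k_def q_def)
    ultimately show ?thesis by (simp add: a_def)
  qed
  have a\<gamma>: "a * \<gamma> = a + 2" using \<open>\<gamma> > 1\<close> by (simp add: a_def field_simps)
  have K\<gamma>: "K powr \<gamma> = K * C"
  proof -
    have "\<gamma> / (\<gamma> - 1) = 1 / (\<gamma> - 1) + 1" using \<open>\<gamma> > 1\<close> by (simp add: field_simps)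
    then show ?thesis using \<open>C > 0\<close> by (simp add: K_def powr_powr powr_add)
  qed
  have momentum_balance: "A * C * (a + 2) - k * (a + 1) + k\<^sup>2 * (a + CARD('n) + 1) = 0"
  proof -
    have "k\<^sup>2 * (a + CARD('n) + 1) = k * (k * (a + CARD('n))) + k * k"
      by (simp add: power2_eq_square algebra_simps)
    then show ?thesis unfolding balance kan by (simp add: algebra_simps)
  qed
  have \<rho>': "\<rho> t x = K * (T - t) powr - a * norm x powr a" if "t \<in> {0..<T}" for t x
    using \<rho>[OF that] that by (simp add: K_def powr_divide powr_minus divide_simps)
  show ?thesis
    unfolding NS_solution_def NS_regular_at_def
  proof (intro ballI allI)
    fix t x assume t: "t \<in> {0..<T}"
    define \<tau> where "\<tau> = T - t"
    have "\<tau> > 0" using t by (simp add: \<tau>_def)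
    \<comment> \<open>The common factor of the momentum equation; all other powers of \<open>\<tau>\<close> are reduced to it.\<close>
    define r where "r = \<tau> powr (- a - 2)"
    have \<tau>a: "\<tau> powr - a = r * \<tau> * \<tau>" "\<tau> powr (- a - 1) = r * \<tau>"
      "\<tau> powr (- (a + 1) - 1) = r"
    proof -
      have "r = \<tau> powr - a / \<tau>\<^sup>2" "\<tau> powr (- a - 1) = \<tau> powr - a / \<tau>"
        using \<open>\<tau> > 0\<close> powr_diff[of \<tau> "- a" 2] powr_diff[of \<tau> "- a" 1] by (simp_all add: r_def)
      then show "\<tau> powr - a = r * \<tau> * \<tau>" "\<tau> powr (- a - 1) = r * \<tau>"
        using \<open>\<tau> > 0\<close> by (simp_all add: power2_eq_square)
      have "- (a + 1) - 1 = - a - 2" by simp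
      then show "\<tau> powr (- (a + 1) - 1) = r" by (simp only: r_def)
    qed
    have ut: "u t = (\<lambda>y. (- (k / \<tau>)) *\<^sub>R y)"
      using u[OF t] by (auto simp: \<tau>_def)
    have \<rho>t: "\<rho> t y = K * (r * \<tau> * \<tau>) * norm y powr a" for y
      using \<rho>'[OF t] \<tau>a by (simp add: \<tau>_def)
    have mass_flux: "(\<lambda>y. \<rho> t y *\<^sub>R u t y)
        = (\<lambda>y. (norm y powr a) *\<^sub>R ((- (k * K * r * \<tau>)) *\<^sub>R y))"
      using \<open>\<tau> > 0\<close> by (auto simp: ut \<rho>t field_simps)
    have momentum_flux: "(\<lambda>y. \<rho> t y *\<^sub>R tensor_product (u t y) (u t y))
        = (\<lambda>y. (norm y powr a) *\<^sub>R ((k\<^sup>2 * K * r) *\<^sub>R tensor_product y y))"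
      using \<open>\<tau> > 0\<close>
      by (auto simp: ut \<rho>t tensor_product_def vec_eq_iff power2_eq_square field_simps)
    have pressure: "(\<lambda>y. A * \<rho> t y powr \<gamma>) = (\<lambda>y. (A * C * K * r) * norm y powr (a + 2))"
    proof
      fix y
      have "\<rho> t y powr \<gamma> = K powr \<gamma> * \<tau> powr (- (a * \<gamma>)) * norm y powr (a * \<gamma>)"
        using \<rho>'[OF t] by (simp add: \<tau>_def powr_mult powr_powr K_def)
      then show "A * \<rho> t y powr \<gamma> = (A * C * K * r) * norm y powr (a + 2)"
        unfolding a\<gamma> K\<gamma> by (simp add: r_def)
    qed
    have \<rho>_time: "\<rho> s x = ((T - s) powr - a) *\<^sub>R (K * norm x powr a)" if "s \<in> {0..<T}" for s
      using \<rho>'[OF that] by simp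
    have \<rho>u_time: "\<rho> s x *\<^sub>R u s x
        = ((T - s) powr - (a + 1)) *\<^sub>R ((- (k * K * norm x powr a)) *\<^sub>R x)"
      if "s \<in> {0..<T}" for s
    proof -
      have "(T - s) powr - (a + 1) = (T - s) powr - a / (T - s)"
        using that powr_diff[of "T - s" "- a" 1] by simp
      then show ?thesis
        unfolding \<rho>'[OF that] u[OF that] by (simp add: field_simps)
    qed
    have dt_\<rho>: "(\<lambda>s. \<rho> s x) differentiable (at t within {0..<T})"
      "vector_derivative (\<lambda>s. \<rho> s x) (at t within {0..<T})
        = (a * \<tau> powr (- a - 1)) *\<^sub>R (K * norm x powr a)"
      unfolding \<tau>_def by (rule powr_blowup_time_derivative[OF t \<rho>_time], assumption)+
    have dt_\<rho>u: "(\<lambda>s. \<rho> s x *\<^sub>R u s x) differentiable (at t within {0..<T})"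
      "vector_derivative (\<lambda>s. \<rho> s x *\<^sub>R u s x) (at t within {0..<T})
        = ((a + 1) * \<tau> powr (- (a + 1) - 1)) *\<^sub>R ((- (k * K * norm x powr a)) *\<^sub>R x)"
      unfolding \<tau>_def by (rule powr_blowup_time_derivative[OF t \<rho>u_time], assumption)+
    have nonneg: "0 \<le> \<rho> t x" using \<rho>[OF t] by simp
    have regular: "(\<lambda>s. \<rho> s x) differentiable (at t within {0..<T}) \<and>
       (\<lambda>s. \<rho> s x *\<^sub>R u s x) differentiable (at t within {0..<T}) \<and>
       (\<lambda>y. \<rho> t y *\<^sub>R u t y) differentiable (at x) \<and>
       (\<lambda>y. \<rho> t y *\<^sub>R tensor_product (u t y) (u t y)) differentiable (at x) \<and>
       (\<lambda>y. A * \<rho> t y powr \<gamma>) differentiable (at x) \<and>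
       (\<forall>y. u t differentiable (at y)) \<and>
       (\<forall>j. partial_deriv j (u t) differentiable (at x))"
      unfolding mass_flux momentum_flux pressure
      unfolding ut partial_deriv_scaleR
      by (intro conjI allI dt_\<rho>(1) dt_\<rho>u(1) norm_powr_field(1) norm_powr_tensor(1)
          norm_powr_gradient(1) differentiable_const \<open>a > 0\<close>
          bounded_linear_imp_differentiable bounded_linear_scaleR_right)
    have continuity: "vector_derivative (\<lambda>s. \<rho> s x) (at t within {0..<T})
        + divergence (\<lambda>y. \<rho> t y *\<^sub>R u t y) x = 0"
    proof -
      have "(a * (r * \<tau>)) *\<^sub>R (K * norm x powr a)
          + - (k * K * r * \<tau>) * (a + CARD('n)) * norm x powr a
          = (a - k * (a + CARD('n))) * (K * r * \<tau> * norm x powr a)"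
        by (simp add: algebra_simps)
      also have "\<dots> = 0" using kan by simp
      finally show ?thesis
        unfolding mass_flux dt_\<rho>(2) norm_powr_field(2)[OF \<open>a > 0\<close>] \<tau>a .
    qed
    have momentum: "vector_derivative (\<lambda>s. \<rho> s x *\<^sub>R u s x) (at t within {0..<T})
          + tensor_divergence (\<lambda>y. \<rho> t y *\<^sub>R tensor_product (u t y) (u t y)) x
          + gradient (\<lambda>y. A * \<rho> t y powr \<gamma>) x
        = \<mu> *\<^sub>R laplacian (u t) x + (lam + \<mu>) *\<^sub>R gradient (divergence (u t)) x"
    proof -
      have "((a + 1) * r) *\<^sub>R ((- (k * K * norm x powr a)) *\<^sub>R x)
          + (k\<^sup>2 * K * r * (a + CARD('n) + 1) * norm x powr a) *\<^sub>R x
          + (A * C * K * r * (a + 2) * norm x powr a) *\<^sub>R x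
          = ((A * C * (a + 2) - k * (a + 1) + k\<^sup>2 * (a + CARD('n) + 1))
              * (K * r * norm x powr a)) *\<^sub>R x"
        by (simp add: vec_eq_iff algebra_simps)
      also have "\<dots> = 0" by (simp add: momentum_balance)
      finally show ?thesis
        unfolding momentum_flux pressure dt_\<rho>u(2) norm_powr_tensor(2)[OF \<open>a > 0\<close>]
          norm_powr_gradient(2)[OF \<open>a > 0\<close>] \<tau>a
        unfolding ut viscous_terms_scaleR by simp
    qed
    show "0 \<le> \<rho> t x \<and> ((\<lambda>s. \<rho> s x) differentiable (at t within {0..<T}) \<and>
       (\<lambda>s. \<rho> s x *\<^sub>R u s x) differentiable (at t within {0..<T}) \<and>
       (\<lambda>y. \<rho> t y *\<^sub>R u t y) differentiable (at x) \<and>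
       (\<lambda>y. \<rho> t y *\<^sub>R tensor_product (u t y) (u t y)) differentiable (at x) \<and>
       (\<lambda>y. A * \<rho> t y powr \<gamma>) differentiable (at x) \<and>
       (\<forall>y. u t differentiable (at y)) \<and>
       (\<forall>j. partial_deriv j (u t) differentiable (at x))) \<and>
       vector_derivative (\<lambda>s. \<rho> s x) (at t within {0..<T})
        + divergence (\<lambda>y. \<rho> t y *\<^sub>R u t y) x = 0 \<and>
       vector_derivative (\<lambda>s. \<rho> s x *\<^sub>R u s x) (at t within {0..<T})
          + tensor_divergence (\<lambda>y. \<rho> t y *\<^sub>R tensor_product (u t y) (u t y)) x
          + gradient (\<lambda>y. A * \<rho> t y powr \<gamma>) x
        = \<mu> *\<^sub>R laplacian (u t) x + (lam + \<mu>) *\<^sub>R gradient (divergence (u t)) x"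
      by (intro conjI[OF nonneg] conjI[OF regular] conjI[OF continuity] momentum)
  qed
qed

theorem theorem1p7:
  fixes A \<gamma> \<mu> lam T C :: real
    and \<rho> :: "real \<Rightarrow> real^'n::finite \<Rightarrow> real"
    and u :: "real \<Rightarrow> real^'n \<Rightarrow> real^'n"
  assumes "CARD('n) \<in> {2, 3}"
    and "A > 0" and "\<gamma> > 1"
    and "\<mu> > 0" and "real CARD('n) * lam + 2 * \<mu> > 0"
    and "T > 0"
    and "CARD('n) = 2 \<Longrightarrow> C = (\<gamma> - 1)\<^sup>2 / (2 * A * \<gamma> ^ 3)"
    and "CARD('n) = 3 \<Longrightarrow> C = 3 * (\<gamma> - 1)\<^sup>2 / (A * \<gamma> * (3 * \<gamma> - 1)\<^sup>2)"
    and "\<And>t x. t \<in> {0..<T} \<Longrightarrow>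
           \<rho> t x = C powr (1 / (\<gamma> - 1)) * (norm x / (T - t)) powr (2 / (\<gamma> - 1))"
    and "\<And>t x. t \<in> {0..<T} \<Longrightarrow>
           u t x = - (2 / ((real CARD('n) * (\<gamma> - 1) + 2) * (T - t))) *\<^sub>R x"
  shows "NS_solution A \<gamma> \<mu> lam {0..<T} \<rho> u"
proof (rule self_similar_NS_solution)
  have a2: "2 / (\<gamma> - 1) + 2 = 2 * \<gamma> / (\<gamma> - 1)" using \<open>\<gamma> > 1\<close> by (simp add: field_simps)
  have "C > 0 \<and> A * C * (2 / (\<gamma> - 1) + 2) = 2 / (real CARD('n) * (\<gamma> - 1) + 2) *
      (1 - 2 / (real CARD('n) * (\<gamma> - 1) + 2))"
  proof (cases "CARD('n) = 2")
    case True
    have k: "2 / (real CARD('n) * (\<gamma> - 1) + 2) = 1 / \<gamma>"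
      using True \<open>\<gamma> > 1\<close> by (simp add: field_simps)
    have "C = (\<gamma> - 1)\<^sup>2 / (2 * A * \<gamma> ^ 3)" using True assms(7) by blast
    moreover from this have "C > 0" using \<open>A > 0\<close> \<open>\<gamma> > 1\<close> by simp
    ultimately show ?thesis
      unfolding a2 k using \<open>A > 0\<close> \<open>\<gamma> > 1\<close>
      by (simp add: divide_simps power2_eq_square power3_eq_cube) (simp add: algebra_simps)
  next
    case False
    then have 3: "CARD('n) = 3" using assms(1) by blast
    have k: "2 / (real CARD('n) * (\<gamma> - 1) + 2) = 2 / (3 * \<gamma> - 1)"
      using 3 by (simp add: algebra_simps)
    have k1: "1 - 2 / (3 * \<gamma> - 1) = 3 * (\<gamma> - 1) / (3 * \<gamma> - 1)"
      using \<open>\<gamma> > 1\<close> by (simp add: field_simps)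
    have "C = 3 * (\<gamma> - 1)\<^sup>2 / (A * \<gamma> * (3 * \<gamma> - 1)\<^sup>2)" using 3 assms(8) by blast
    moreover from this have "C > 0" using \<open>A > 0\<close> \<open>\<gamma> > 1\<close> by simp
    ultimately show ?thesis
      unfolding a2 k k1 using \<open>A > 0\<close> \<open>\<gamma> > 1\<close>
      by (simp add: divide_simps power2_eq_square) (simp add: algebra_simps)
  qed
  then show "C > 0" and "A * C * (2 / (\<gamma> - 1) + 2) = 2 / (real CARD('n) * (\<gamma> - 1) + 2) *
      (1 - 2 / (real CARD('n) * (\<gamma> - 1) + 2))" by auto
qed (use assms in auto)

end
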